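(* Let $d\in\mathbb{N}$ and $\mathbb{X}\subseteq\mathbb{R}^d$. For each $K\in\mathbb{N}$, the soft-max gating class is contained in the Gaussian gating class, $\mathcal{G}_S^K\subseteq\mathcal{G}_G^K$. Further, the class of Gaussian gating vectors with equal covariance matrices is contained in the soft-max gating class, $\mathcal{G}_E^K\subseteq\mathcal{G}_S^K$.
   Context: $[K]=\{1,\dots,K\}$. $\mathbb{S}_d$ is the set of $d\times d$ symmetric positive definite matrices, $\Pi_{K-1}=\{(\pi_k)_{k\in[K]}\,|\,\pi_k>0\ \forall k\in[K],\ \sum_{k=1}^K\pi_k=1\}$, and $$\phi(\boldsymbol{x};\boldsymbol{\nu},\boldsymbol{\Sigma})=|2\pi\boldsymbol{\Sigma}|^{-1/2}\exp\left[-\tfrac12(\boldsymbol{x}-\boldsymbol{\nu})^\top\boldsymbol{\Sigma}^{-1}(\boldsymbol{x}-\boldsymbol{\nu})\right]$$ is the multivariate normal density with mean $\boldsymbol{\nu}\in\mathbb{R}^d$ and covariance $\boldsymbol{\Sigma}\in\mathbb{S}_d$. The following are classes of vectors $\mathbf{Gate}=(\mathrm{Gate}_k)_{k\in[K]}$ of functions of $\boldsymbol{x}\in\mathbb{X}$. $\mathcal{G}_S^K$ (soft-max gates): all vectors with $$\mathrm{Gate}_k(\boldsymbol{x})=\frac{\exp(a_k+\boldsymbol{b}_k^\top\boldsymbol{x})}{\sum_{l=1}^K\exp(a_l+\boldsymbol{b}_l^\top\boldsymbol{x})},\quad k\in[K],$$ for some $a_1,\dots,a_K\in\mathbb{R}$,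 $\boldsymbol{b}_1,\dots,\boldsymbol{b}_K\in\mathbb{R}^d$. $\mathcal{G}_G^K$ (Gaussian gates): all vectors with $$\mathrm{Gate}_k(\boldsymbol{x})=\frac{\pi_k\phi(\boldsymbol{x};\boldsymbol{\nu}_k,\boldsymbol{\Sigma}_k)}{\sum_{l=1}^K\pi_l\phi(\boldsymbol{x};\boldsymbol{\nu}_l,\boldsymbol{\Sigma}_l)},\quad k\in[K],$$ for some $(\pi_k)_{k\in[K]}\in\Pi_{K-1}$, $\boldsymbol{\nu}_1,\dots,\boldsymbol{\nu}_K\in\mathbb{R}^d$, $\boldsymbol{\Sigma}_1,\dots,\boldsymbol{\Sigma}_K\in\mathbb{S}_d$. $\mathcal{G}_E^K$ (Gaussian gates with equal covariance matrices): all vectors with $$\mathrm{Gate}_k(\boldsymbol{x})=\frac{\pi_k\phi(\boldsymbol{x};\boldsymbol{\nu}_k,\boldsymbol{\Sigma})}{\sum_{l=1}^K\pi_l\phi(\boldsymbol{x};\boldsymbol{\nu}_l,\boldsymbol{\Sigma})},\quad k\in[K],$$ for some $(\pi_k)_{k\in[K]}\in\Pi_{K-1}$, $\boldsymbol{\nu}_1,\dots,\boldsymbol{\nu}_K\in\mathbb{R}^d$, $\boldsymbol{\Sigma}\in\mathbb{S}_d$. *)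

theory Defs
  imports "HOL-Analysis.Analysis"
begin

definition spd_matrices :: "(real^'d^'d) set" where
  "spd_matrices = {S. transpose S = S \<and> (\<forall>v. v \<noteq> 0 \<longrightarrow> v \<bullet> (S *v v) > 0)}"

definition mvn_density :: "real^'d \<Rightarrow> real^'d \<Rightarrow> real^'d^'d \<Rightarrow> real" where
  "mvn_density x \<nu> \<Sigma> =
     det ((2 * pi) *\<^sub>R \<Sigma>) powr (- 1 / 2) *
     exp (- (1 / 2) * ((x - \<nu>) \<bullet> (matrix_inv \<Sigma> *v (x - \<nu>))))"

(* A vector indexed by [K] is a function on {1..K}, extended by undefined elsewhere. *)

definition open_simplex :: "nat \<Rightarrow> (nat \<Rightarrow> real) set" where
  "open_simplex K = {p \<in> {1..K} \<rightarrow>\<^sub>E {0<..}. (\<Sum>k=1..K. p k) = 1}"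

(* The gates are functions of x in X only. They are made extensional by the restricted lambda,
   so that equality of two gating vectors is equality of their values at every k in [K]
   and x in X. *)

definition softmax_gates :: "nat \<Rightarrow> (real^'d) set \<Rightarrow> (nat \<Rightarrow> real^'d \<Rightarrow> real) set" where
  "softmax_gates K X =
     {Gate. \<exists>(a :: nat \<Rightarrow> real) (b :: nat \<Rightarrow> real^'d).
        Gate = (\<lambda>k\<in>{1..K}. \<lambda>x\<in>X. exp (a k + b k \<bullet> x) / (\<Sum>l=1..K. exp (a l + b l \<bullet> x)))}"

definition gaussian_gates :: "nat \<Rightarrow> (real^'d) set \<Rightarrow> (nat \<Rightarrow> real^'d \<Rightarrow> real) set" where
  "gaussian_gates K X =
     {Gate. \<exists>p \<in> open_simplex K. \<exists>\<nu> :: nat \<Rightarrow> real^'d. \<exists>\<Sigma> :: nat \<Rightarrow> real^'d^'d.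
        (\<forall>k\<in>{1..K}. \<Sigma> k \<in> spd_matrices) \<and>
        Gate = (\<lambda>k\<in>{1..K}. \<lambda>x\<in>X. p k * mvn_density x (\<nu> k) (\<Sigma> k) /
                                 (\<Sum>l=1..K. p l * mvn_density x (\<nu> l) (\<Sigma> l)))}"

definition equal_cov_gaussian_gates :: "nat \<Rightarrow> (real^'d) set \<Rightarrow> (nat \<Rightarrow> real^'d \<Rightarrow> real) set" where
  "equal_cov_gaussian_gates K X =
     {Gate. \<exists>p \<in> open_simplex K. \<exists>\<nu> :: nat \<Rightarrow> real^'d. \<exists>\<Sigma> \<in> spd_matrices.
        Gate = (\<lambda>k\<in>{1..K}. \<lambda>x\<in>X. p k * mvn_density x (\<nu> k) \<Sigma> /
                                 (\<Sum>l=1..K. p l * mvn_density x (\<nu> l) \<Sigma>))}"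

end

theory Submission
  imports Defs
begin

text \<open>
  Expanding the quadratic form in a Gaussian density with precision matrix
  \<open>M\<close> shows that, up to a positive factor depending only on \<open>M\<close> and \<open>x\<close>, the density is
  the exponential of an affine function of \<open>x\<close> with slope \<open>M\<nu>\<close>.
  When all components share the covariance matrix, this factor cancels in the gate, leaving a soft-max
  gate. Conversely, a soft-max gate with slopes \<open>b\<^sub>k\<close> arises from identity covariances and means
  \<open>b\<^sub>k\<close>, with mixing weights chosen to match the intercepts.
\<close>

lemma matrix_mul_matrix_inv_right:
  assumes "invertible A"
  shows "A ** matrix_inv A = mat 1"
  using assms unfolding invertible_def matrix_inv_def
  by (metis (mono_tags, lifting) someI_ex)

lemma spd_invertible:
  fixes S :: "real^'d^'d"
  assumes "S \<in> spd_matrices"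
  shows "invertible S"
proof -
  have "S *v v = 0 \<Longrightarrow> v = 0" for v
    using assms by (fastforce simp: spd_matrices_def)
  then show ?thesis
    by (metis invertible_left_inverse matrix_left_invertible_ker)
qed

text \<open>Writing \<open>v\<close> and \<open>w\<close> as images under \<open>S\<close> reduces
  this to the symmetry of \<open>S\<close>. It merges the two cross terms of the expanded quadratic
  form.\<close>

lemma spd_matrix_inv_selfadjoint:
  fixes S :: "real^'d^'d"
  assumes S: "S \<in> spd_matrices"
  shows "(matrix_inv S *v v) \<bullet> w = v \<bullet> (matrix_inv S *v w)"
proof -
  have inv: "S *v (matrix_inv S *v u) = u" for u
    using matrix_mul_matrix_inv_right[OF spd_invertible[OF S]]
    by (simp add: matrix_vector_mul_assoc)
  have adj: "(S *v u) \<bullet> t = u \<bullet> (S *v t)" for u t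
    using S by (metis (mono_tags, lifting) dot_lmul_matrix mem_Collect_eq spd_matrices_def
        transpose_matrix_vector)
  show ?thesis
    by (metis adj inv)
qed

lemma mat_1_spd: "mat 1 \<in> spd_matrices"
  by (simp add: spd_matrices_def transpose_mat)

text \<open>The factor \<open>g\<close> is fixed before \<open>\<nu>\<close>, so at a given
  \<open>x\<close> one factor serves all components with covariance \<open>S\<close>.\<close>

lemma mvn_density_factorization:
  fixes S :: "real^'d^'d"
  assumes S: "S \<in> spd_matrices"
  obtains g where "g > 0"
    "\<And>\<nu>. mvn_density x \<nu> S =
       g * exp ((matrix_inv S *v \<nu>) \<bullet> x - \<nu> \<bullet> (matrix_inv S *v \<nu>) / 2)"
proof
  let ?M = "matrix_inv S"
  let ?g = "det ((2 * pi) *\<^sub>R S) powr (- 1 / 2) * exp (- (x \<bullet> (?M *v x)) / 2)"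
  have "invertible ((2 * pi) *\<^sub>R S)"
    using spd_invertible[OF S] by (simp add: scalar_invertible)
  \<comment> \<open>\<open>r powr a\<close> is positive for every nonzero \<open>r\<close>, so the sign of the determinant is irrelevant.\<close>
  then show "?g > 0"
    by (simp add: invertible_det_nz)
  show "mvn_density x \<nu> S = ?g * exp ((?M *v \<nu>) \<bullet> x - \<nu> \<bullet> (?M *v \<nu>) / 2)" for \<nu>
  proof -
    have "- (1 / 2) * ((x - \<nu>) \<bullet> (?M *v (x - \<nu>))) =
        - (x \<bullet> (?M *v x)) / 2 + ((?M *v \<nu>) \<bullet> x - \<nu> \<bullet> (?M *v \<nu>) / 2)"
      using spd_matrix_inv_selfadjoint[OF S, of \<nu> x]
      by (simp add: matrix_vector_mult_diff_distrib inner_diff_left inner_diff_right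
          inner_commute field_simps)
    then show ?thesis
      unfolding mvn_density_def by (simp only: exp_add mult.assoc)
  qed
qed

text \<open>The common factor \<open>c\<close> cancels; if the sum of \<open>v\<close> vanishes,
  both quotients are 0 because division by 0 yields 0.\<close>

lemma normalized_scale:
  fixes u v :: "'i \<Rightarrow> real"
  assumes "c \<noteq> 0" and "\<And>l. l \<in> I \<Longrightarrow> u l = c * v l" and "k \<in> I"
  shows "u k / (\<Sum>l\<in>I. u l) = v k / (\<Sum>l\<in>I. v l)"
  using assms by (simp flip: sum_distrib_left)

text \<open>Common core of both inclusions: the quadratic term in the weight \<open>p l\<close>
  cancels the one left by the density, and \<open>C\<close> leaves room for normalizing the
  weights.\<close>

lemma gaussian_gate_eq_softmax_gate:
  fixes S :: "real^'d^'d"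
  assumes S: "S \<in> spd_matrices" and "C > 0" "k \<in> I"
    and p: "\<And>l. l \<in> I \<Longrightarrow> p l = C * exp (a l + \<nu> l \<bullet> (matrix_inv S *v \<nu> l) / 2)"
  shows "p k * mvn_density x (\<nu> k) S / (\<Sum>l\<in>I. p l * mvn_density x (\<nu> l) S) =
    exp (a k + (matrix_inv S *v \<nu> k) \<bullet> x) / (\<Sum>l\<in>I. exp (a l + (matrix_inv S *v \<nu> l) \<bullet> x))"
proof -
  obtain g where g: "g > 0"
    "\<And>\<nu>. mvn_density x \<nu> S =
       g * exp ((matrix_inv S *v \<nu>) \<bullet> x - \<nu> \<bullet> (matrix_inv S *v \<nu>) / 2)"
    using mvn_density_factorization[OF S] by blast
  show ?thesis
    by (rule normalized_scale[where c = "C * g"])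
      (use assms g in \<open>simp_all add: p exp_add exp_diff\<close>)
qed

lemma softmax_subset_gaussian:
  fixes X :: "(real^'d) set"
  assumes "K \<ge> 1"
  shows "softmax_gates K X \<subseteq> gaussian_gates K X"
proof
  fix Gate assume "Gate \<in> softmax_gates K X"
  then obtain a :: "nat \<Rightarrow> real" and b :: "nat \<Rightarrow> real^'d" where Gate:
    "Gate = (\<lambda>k\<in>{1..K}. \<lambda>x\<in>X. exp (a k + b k \<bullet> x) / (\<Sum>l=1..K. exp (a l + b l \<bullet> x)))"
    unfolding softmax_gates_def by blast
  \<comment> \<open>With covariance \<open>mat 1\<close> and mean \<open>b k\<close>, the density
    contributes \<open>exp (- (b k \<bullet> b k) / 2)\<close>, which this weight
    compensates.\<close>
  define w where "w k = exp (a k + b k \<bullet> b k / 2)" for k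
  define W where "W = (\<Sum>l=1..K. w l)"
  \<comment> \<open>Dividing by \<open>W\<close> makes the weights sum to 1, and the restriction
    makes \<open>p\<close> extensional, as \<open>open_simplex\<close> demands.\<close>
  define p where "p = (\<lambda>k\<in>{1..K}. w k / W)"
  \<comment> \<open>Here \<open>K \<ge> 1\<close> enters: the sum must be nonempty.\<close>
  have "W > 0"
    unfolding W_def w_def using assms by (intro sum_pos) auto
  have p: "p \<in> open_simplex K"
    using \<open>W > 0\<close> by (auto simp: open_simplex_def p_def w_def W_def simp flip: sum_divide_distrib)
  have inv: "matrix_inv (mat 1) = (mat 1 :: real^'d^'d)"
    using matrix_mul_matrix_inv_right[OF spd_invertible[OF mat_1_spd]] by simp
  have "Gate = (\<lambda>k\<in>{1..K}. \<lambda>x\<in>X. p k * mvn_density x (b k) (mat 1) /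
      (\<Sum>l=1..K. p l * mvn_density x (b l) (mat 1)))"
    unfolding Gate
    using gaussian_gate_eq_softmax_gate[OF mat_1_spd, of "1 / W" _ "{1..K}" p a b] \<open>W > 0\<close>
    by (intro restrict_ext) (simp add: inv p_def w_def)
  with p mat_1_spd show "Gate \<in> gaussian_gates K X"
    unfolding gaussian_gates_def
    by (intro CollectI bexI[of _ p] exI[of _ b] exI[of _ "\<lambda>_. mat 1"]) auto
qed

lemma equal_cov_gaussian_subset_softmax:
  fixes X :: "(real^'d) set"
  shows "equal_cov_gaussian_gates K X \<subseteq> softmax_gates K X"
proof
  fix Gate assume "Gate \<in> equal_cov_gaussian_gates K X"
  then obtain p and \<nu> :: "nat \<Rightarrow> real^'d" and S where p: "p \<in> open_simplex K"
    and S: "S \<in> spd_matrices"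
    and Gate: "Gate = (\<lambda>k\<in>{1..K}. \<lambda>x\<in>X. p k * mvn_density x (\<nu> k) S /
      (\<Sum>l=1..K. p l * mvn_density x (\<nu> l) S))"
    unfolding equal_cov_gaussian_gates_def by blast
  define b where "b k = matrix_inv S *v \<nu> k" for k
  \<comment> \<open>The intercept solves \<open>p k = exp (a k + \<nu> k \<bullet> b k / 2)\<close>,
    which is possible since \<open>p k\<close> is positive.\<close>
  define a where "a k = ln (p k) - \<nu> k \<bullet> b k / 2" for k
  have "p l = 1 * exp (a l + \<nu> l \<bullet> (matrix_inv S *v \<nu> l) / 2)" if "l \<in> {1..K}" for l
  proof -
    have "p l > 0"
      using p that unfolding open_simplex_def by fastforce
    then show ?thesis
      by (simp add: a_def b_def)
  qed
  then have "Gate = (\<lambda>k\<in>{1..K}. \<lambda>x\<in>X. exp (a k + b k \<bullet> x) / (\<Sum>l=1..K. exp (a l + b l \<bullet> x)))"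
    unfolding Gate b_def
    by (intro restrict_ext gaussian_gate_eq_softmax_gate[OF S, where C = 1]) auto
  then show "Gate \<in> softmax_gates K X"
    unfolding softmax_gates_def by blast
qed

theorem lemma1:
  fixes X :: "(real^'d) set" and K :: nat
  assumes "K \<ge> 1"
  shows "softmax_gates K X \<subseteq> gaussian_gates K X \<and>
         equal_cov_gaussian_gates K X \<subseteq> softmax_gates K X"
  using softmax_subset_gaussian[OF assms] equal_cov_gaussian_subset_softmax by blast

end
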